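(* Let $\mathcal Q$ be a locally small category-like structure with hom-sets complete lattices and two compositions such that $(\mathcal Q,\otimes,\top_a)$ and $(\mathcal Q^{co},\oplus,\bot_a)$ are quantaloids (with the same objects and the same underlying hom-sets). Then $(\mathcal Q\text{-}\mathsf{Mod},\otimes,\oplus)$, consisting of linear $\mathcal Q$-categories and linear $\mathcal Q$-modules with the order, compositions and identities given in the context, is a linear quantaloid if and only if $(\mathcal Q,\otimes,\oplus)$ is a linear quantaloid.
   Context: A quantaloid is a category enriched in complete lattices and sup-preserving maps; composition is written in diagrammatic order. $\mathcal Q^{co}$ denotes $\mathcal Q$ with the order on each hom reversed, so $(\mathcal Q^{co},\oplus,\bot_a)$ being a quantaloid means $\oplus$ is associative with identities $\bot_a$ and preserves arbitrary infima in each variable. A linear quantaloid is such a structure satisfying in addition, for all $f\colon a\to b$, $g\colon b\to c$, $h\colon c\to d$: $f\otimes(g\oplus h)\le(f\otimes g)\oplus h$ and $(f\oplus g)\otimes h\le f\oplus(g\otimes h)$. A linear $\mathcal Q$-category $M=(X,\rho)$ consists of a set $X$, a function $\rho\colon X\to\mathrm{ob}\,\mathcal Q$, and for each $(x,x')\in X\times X$ morphisms $M_\otimes(x,x'),M_\oplus(x,x')\colon\rho(x)\to\rho(x')$ in $\mathcal Q$ such that for all $x,x',x''\in X$: - $\top_{\rho(x)}\le M_\otimes(x,x)$ and $M_\otimes(x,x')\otimes M_\otimes(x',x'')\le M_\otimes(x,x'')$; - $M_\oplus(x,x)\le\bot_{\rho(x)}$ and $M_\oplus(x,x'')\le M_\oplus(x,x')\oplus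 M_\oplus(x',x'')$; - $M_\otimes(x,x'')\le M_\oplus(x,x')\oplus M_\otimes(x',x'')$ and $M_\otimes(x,x'')\le M_\otimes(x,x')\oplus M_\oplus(x',x'')$; - $M_\otimes(x,x')\otimes M_\oplus(x',x'')\le M_\oplus(x,x'')$ and $M_\oplus(x,x')\otimes M_\otimes(x',x'')\le M_\oplus(x,x'')$. A linear $\mathcal Q$-module $\Theta\colon M\nrightarrow N$, for $M=(X,\rho_M)$ and $N=(Y,\rho_N)$, assigns to each $(x,y)\in X\times Y$ a morphism $\Theta(x,y)\colon\rho_M(x)\to\rho_N(y)$ such that for all $x,x'\in X$, $y,y'\in Y$: $\Theta(x,y)\otimes N_\otimes(y,y')\le\Theta(x,y')$, $M_\otimes(x,x')\otimes\Theta(x',y)\le\Theta(x,y)$, $\Theta(x,y)\le M_\oplus(x,x')\oplus\Theta(x',y)$, $\Theta(x,y)\le\Theta(x,y')\oplus N_\oplus(y',y)$. $\mathcal Q\text{-}\mathsf{Mod}$ has linear $\mathcal Q$-categories as objects and linear $\mathcal Q$-modules as arrows, ordered pointwise. For $\Theta\colon M\nrightarrow N$, $\Pi\colon N\nrightarrow P$ with $N=(Y,\rho_N)$: $(\Theta\otimes\Pi)(x,z)=\bigvee_{y\in Y}\Theta(x,y)\otimes\Pi(y,z)$ and $(\Theta\oplus\Pi)(x,z)=\bigwedge_{y\in Y}\Theta(x,y)\oplus\Pi(y,z)$. The identity on $M$ for $\otimes$ is $(x,x')\mapsto M_\otimes(x,x')$ and for $\oplus$ is $(x,x')\mapsto M_\oplus(x,x')$.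 That $\mathcal Q\text{-}\mathsf{Mod}$ is a linear quantaloid includes that these compositions and identities are well defined. *)

theory Defs
  imports "HOL-Algebra.Complete_Lattice" "HOL-Library.FuncSet"
begin

section \<open>Quantaloids\<close>

text \<open>
  Hom-sets are allowed to overlap, so composition carries the three objects involved:
  \<open>comp a b c f g\<close> is the composite of \<open>f : a \<rightarrow> b\<close> and
  \<open>g : b \<rightarrow> c\<close>, in diagrammatic order.
\<close>

locale quantaloid =
  fixes Ob :: "'o set"
    and Hom :: "'o \<Rightarrow> 'o \<Rightarrow> 'm gorder"
    and comp :: "'o \<Rightarrow> 'o \<Rightarrow> 'o \<Rightarrow> 'm \<Rightarrow> 'm \<Rightarrow> 'm"
    and ident :: "'o \<Rightarrow> 'm"
  assumes Hom_complete: "\<lbrakk>a \<in> Ob; b \<in> Ob\<rbrakk> \<Longrightarrow> complete_lattice (Hom a b)"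
    and ident_closed: "a \<in> Ob \<Longrightarrow> ident a \<in> carrier (Hom a a)"
    and comp_closed:
      "\<lbrakk>a \<in> Ob; b \<in> Ob; c \<in> Ob; f \<in> carrier (Hom a b); g \<in> carrier (Hom b c)\<rbrakk>
        \<Longrightarrow> comp a b c f g \<in> carrier (Hom a c)"
    and comp_assoc:
      "\<lbrakk>a \<in> Ob; b \<in> Ob; c \<in> Ob; d \<in> Ob;
        f \<in> carrier (Hom a b); g \<in> carrier (Hom b c); h \<in> carrier (Hom c d)\<rbrakk>
        \<Longrightarrow> comp a c d (comp a b c f g) h = comp a b d f (comp b c d g h)"
    and ident_left:
      "\<lbrakk>a \<in> Ob; b \<in> Ob; f \<in> carrier (Hom a b)\<rbrakk> \<Longrightarrow> comp a a b (ident a) f = f"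
    and ident_right:
      "\<lbrakk>a \<in> Ob; b \<in> Ob; f \<in> carrier (Hom a b)\<rbrakk> \<Longrightarrow> comp a b b f (ident b) = f"
    and comp_Sup_left:
      "\<lbrakk>a \<in> Ob; b \<in> Ob; c \<in> Ob; A \<subseteq> carrier (Hom a b); g \<in> carrier (Hom b c)\<rbrakk>
        \<Longrightarrow> comp a b c (\<Squnion>\<^bsub>Hom a b\<^esub> A) g = \<Squnion>\<^bsub>Hom a c\<^esub> ((\<lambda>f. comp a b c f g) ` A)"
    and comp_Sup_right:
      "\<lbrakk>a \<in> Ob; b \<in> Ob; c \<in> Ob; f \<in> carrier (Hom a b); B \<subseteq> carrier (Hom b c)\<rbrakk>
        \<Longrightarrow> comp a b c f (\<Squnion>\<^bsub>Hom b c\<^esub> B) = \<Squnion>\<^bsub>Hom a c\<^esub> ((\<lambda>g. comp a b c f g) ` B)"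

text \<open>
  The raw data shared by \<open>\<Q>\<close> and \<open>\<Q>-Mod\<close>: the compositions
  \<open>\<otimes>\<close> (\<open>tensor\<close>) and \<open>\<oplus>\<close> (\<open>par\<close>), with units
  \<open>\<top>\<^sub>a\<close> (\<open>tunit a\<close>) and \<open>\<bottom>\<^sub>a\<close> (\<open>punit a\<close>).  The units are
  not the greatest and least elements of the lattice \<open>Hom a a\<close>.
\<close>

record ('o, 'm) lin_data =
  Ob :: "'o set"
  Hom :: "'o \<Rightarrow> 'o \<Rightarrow> 'm gorder"
  tensor :: "'o \<Rightarrow> 'o \<Rightarrow> 'o \<Rightarrow> 'm \<Rightarrow> 'm \<Rightarrow> 'm"
  tunit :: "'o \<Rightarrow> 'm"
  par :: "'o \<Rightarrow> 'o \<Rightarrow> 'o \<Rightarrow> 'm \<Rightarrow> 'm \<Rightarrow> 'm"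
  punit :: "'o \<Rightarrow> 'm"

locale quantaloid_pair =
  fixes Q :: "('o, 'm) lin_data"
  assumes tensor_quantaloid: "quantaloid (Ob Q) (Hom Q) (tensor Q) (tunit Q)"
    and par_co_quantaloid:
      "quantaloid (Ob Q) (\<lambda>a b. inv_gorder (Hom Q a b)) (par Q) (punit Q)"

locale linear_quantaloid = quantaloid_pair Q for Q :: "('o, 'm) lin_data" +
  assumes lin_dist_left:
      "\<lbrakk>a \<in> Ob Q; b \<in> Ob Q; c \<in> Ob Q; d \<in> Ob Q;
        f \<in> carrier (Hom Q a b); g \<in> carrier (Hom Q b c); h \<in> carrier (Hom Q c d)\<rbrakk>
        \<Longrightarrow> tensor Q a b d f (par Q b c d g h)
              \<sqsubseteq>\<^bsub>Hom Q a d\<^esub> par Q a c d (tensor Q a b c f g) h"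
    and lin_dist_right:
      "\<lbrakk>a \<in> Ob Q; b \<in> Ob Q; c \<in> Ob Q; d \<in> Ob Q;
        f \<in> carrier (Hom Q a b); g \<in> carrier (Hom Q b c); h \<in> carrier (Hom Q c d)\<rbrakk>
        \<Longrightarrow> tensor Q a c d (par Q a b c f g) h
              \<sqsubseteq>\<^bsub>Hom Q a d\<^esub> par Q a b d f (tensor Q b c d g h)"


section \<open>Linear Q-categories\<close>

text \<open>
  Sets of objects are subsets of a type \<open>'x\<close>.  Functions with a set as domain are taken
  extensional (\<open>PiE\<close>), so that equality of objects and of modules is the intended one.
  For \<open>M = (X, \<rho>)\<close>, \<open>obj M\<close> is \<open>X\<close> and \<open>ext M\<close> is \<open>\<rho>\<close>.
\<close>

record ('x, 'o, 'm) lin_cat_data =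
  obj :: "'x set"
  ext :: "'x \<Rightarrow> 'o"
  hom_tensor :: "'x \<times> 'x \<Rightarrow> 'm"
  hom_par :: "'x \<times> 'x \<Rightarrow> 'm"

locale linear_category =
  fixes Q :: "('o, 'm) lin_data" and M :: "('x, 'o, 'm) lin_cat_data"
  assumes ext_fun: "ext M \<in> obj M \<rightarrow>\<^sub>E Ob Q"
    and hom_tensor_fun:
      "hom_tensor M \<in> (\<Pi>\<^sub>E (x, x') \<in> obj M \<times> obj M. carrier (Hom Q (ext M x) (ext M x')))"
    and hom_par_fun:
      "hom_par M \<in> (\<Pi>\<^sub>E (x, x') \<in> obj M \<times> obj M. carrier (Hom Q (ext M x) (ext M x')))"
    and tensor_unit:
      "x \<in> obj M \<Longrightarrow> tunit Q (ext M x) \<sqsubseteq>\<^bsub>Hom Q (ext M x) (ext M x)\<^esub> hom_tensor M (x, x)"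
    and tensor_comp:
      "\<lbrakk>x \<in> obj M; x' \<in> obj M; x'' \<in> obj M\<rbrakk> \<Longrightarrow>
        tensor Q (ext M x) (ext M x') (ext M x'') (hom_tensor M (x, x')) (hom_tensor M (x', x''))
          \<sqsubseteq>\<^bsub>Hom Q (ext M x) (ext M x'')\<^esub> hom_tensor M (x, x'')"
    and par_unit:
      "x \<in> obj M \<Longrightarrow> hom_par M (x, x) \<sqsubseteq>\<^bsub>Hom Q (ext M x) (ext M x)\<^esub> punit Q (ext M x)"
    and par_comp:
      "\<lbrakk>x \<in> obj M; x' \<in> obj M; x'' \<in> obj M\<rbrakk> \<Longrightarrow>
        hom_par M (x, x'') \<sqsubseteq>\<^bsub>Hom Q (ext M x) (ext M x'')\<^esub>
          par Q (ext M x) (ext M x') (ext M x'') (hom_par M (x, x')) (hom_par M (x', x''))"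
    and tensor_le_par_tensor:
      "\<lbrakk>x \<in> obj M; x' \<in> obj M; x'' \<in> obj M\<rbrakk> \<Longrightarrow>
        hom_tensor M (x, x'') \<sqsubseteq>\<^bsub>Hom Q (ext M x) (ext M x'')\<^esub>
          par Q (ext M x) (ext M x') (ext M x'') (hom_par M (x, x')) (hom_tensor M (x', x''))"
    and tensor_le_tensor_par:
      "\<lbrakk>x \<in> obj M; x' \<in> obj M; x'' \<in> obj M\<rbrakk> \<Longrightarrow>
        hom_tensor M (x, x'') \<sqsubseteq>\<^bsub>Hom Q (ext M x) (ext M x'')\<^esub>
          par Q (ext M x) (ext M x') (ext M x'') (hom_tensor M (x, x')) (hom_par M (x', x''))"
    and tensor_par_le_par:
      "\<lbrakk>x \<in> obj M; x' \<in> obj M; x'' \<in> obj M\<rbrakk> \<Longrightarrow>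
        tensor Q (ext M x) (ext M x') (ext M x'') (hom_tensor M (x, x')) (hom_par M (x', x''))
          \<sqsubseteq>\<^bsub>Hom Q (ext M x) (ext M x'')\<^esub> hom_par M (x, x'')"
    and par_tensor_le_par:
      "\<lbrakk>x \<in> obj M; x' \<in> obj M; x'' \<in> obj M\<rbrakk> \<Longrightarrow>
        tensor Q (ext M x) (ext M x') (ext M x'') (hom_par M (x, x')) (hom_tensor M (x', x''))
          \<sqsubseteq>\<^bsub>Hom Q (ext M x) (ext M x'')\<^esub> hom_par M (x, x'')"


section \<open>Linear Q-modules\<close>

locale linear_module =
  fixes Q :: "('o, 'm) lin_data"
    and M N :: "('x, 'o, 'm) lin_cat_data"
    and \<Theta> :: "'x \<times> 'x \<Rightarrow> 'm"
  assumes module_fun: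
      "\<Theta> \<in> (\<Pi>\<^sub>E (x, y) \<in> obj M \<times> obj N. carrier (Hom Q (ext M x) (ext N y)))"
    and tensor_right:
      "\<lbrakk>x \<in> obj M; y \<in> obj N; y' \<in> obj N\<rbrakk> \<Longrightarrow>
        tensor Q (ext M x) (ext N y) (ext N y') (\<Theta> (x, y)) (hom_tensor N (y, y'))
          \<sqsubseteq>\<^bsub>Hom Q (ext M x) (ext N y')\<^esub> \<Theta> (x, y')"
    and tensor_left:
      "\<lbrakk>x \<in> obj M; x' \<in> obj M; y \<in> obj N\<rbrakk> \<Longrightarrow>
        tensor Q (ext M x) (ext M x') (ext N y) (hom_tensor M (x, x')) (\<Theta> (x', y))
          \<sqsubseteq>\<^bsub>Hom Q (ext M x) (ext N y)\<^esub> \<Theta> (x, y)"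
    and par_left:
      "\<lbrakk>x \<in> obj M; x' \<in> obj M; y \<in> obj N\<rbrakk> \<Longrightarrow>
        \<Theta> (x, y) \<sqsubseteq>\<^bsub>Hom Q (ext M x) (ext N y)\<^esub>
          par Q (ext M x) (ext M x') (ext N y) (hom_par M (x, x')) (\<Theta> (x', y))"
    and par_right:
      "\<lbrakk>x \<in> obj M; y \<in> obj N; y' \<in> obj N\<rbrakk> \<Longrightarrow>
        \<Theta> (x, y) \<sqsubseteq>\<^bsub>Hom Q (ext M x) (ext N y)\<^esub>
          par Q (ext M x) (ext N y') (ext N y) (\<Theta> (x, y')) (hom_par N (y', y))"

definition module_poset ::
  "('o, 'm) lin_data \<Rightarrow> ('x, 'o, 'm) lin_cat_data \<Rightarrow> ('x, 'o, 'm) lin_cat_data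
    \<Rightarrow> ('x \<times> 'x \<Rightarrow> 'm) gorder" where
  "module_poset Q M N =
    \<lparr>carrier = {\<Theta>. linear_module Q M N \<Theta>},
     eq = (=),
     le = (\<lambda>\<Theta> \<Theta>'. \<forall>x \<in> obj M. \<forall>y \<in> obj N. \<Theta> (x, y) \<sqsubseteq>\<^bsub>Hom Q (ext M x) (ext N y)\<^esub> \<Theta>' (x, y))\<rparr>"

definition module_tensor ::
  "('o, 'm) lin_data \<Rightarrow> ('x, 'o, 'm) lin_cat_data \<Rightarrow> ('x, 'o, 'm) lin_cat_data
    \<Rightarrow> ('x, 'o, 'm) lin_cat_data \<Rightarrow> ('x \<times> 'x \<Rightarrow> 'm) \<Rightarrow> ('x \<times> 'x \<Rightarrow> 'm) \<Rightarrow> 'x \<times> 'x \<Rightarrow> 'm" where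
  "module_tensor Q M N P \<Theta> \<Psi> =
    (\<lambda>(x, z) \<in> obj M \<times> obj P.
      \<Squnion>\<^bsub>Hom Q (ext M x) (ext P z)\<^esub>
        ((\<lambda>y. tensor Q (ext M x) (ext N y) (ext P z) (\<Theta> (x, y)) (\<Psi> (y, z))) ` obj N))"

definition module_par ::
  "('o, 'm) lin_data \<Rightarrow> ('x, 'o, 'm) lin_cat_data \<Rightarrow> ('x, 'o, 'm) lin_cat_data
    \<Rightarrow> ('x, 'o, 'm) lin_cat_data \<Rightarrow> ('x \<times> 'x \<Rightarrow> 'm) \<Rightarrow> ('x \<times> 'x \<Rightarrow> 'm) \<Rightarrow> 'x \<times> 'x \<Rightarrow> 'm" where
  "module_par Q M N P \<Theta> \<Psi> =
    (\<lambda>(x, z) \<in> obj M \<times> obj P.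
      \<Sqinter>\<^bsub>Hom Q (ext M x) (ext P z)\<^esub>
        ((\<lambda>y. par Q (ext M x) (ext N y) (ext P z) (\<Theta> (x, y)) (\<Psi> (y, z))) ` obj N))"

text \<open>
  \<open>QMod Q\<close> is raw data only: that identities and composites of modules are again modules is
  part of \<open>linear_quantaloid (QMod Q)\<close>, through \<open>ident_closed\<close> and
  \<open>comp_closed\<close>.
\<close>

definition QMod ::
  "('o, 'm) lin_data \<Rightarrow> (('x, 'o, 'm) lin_cat_data, 'x \<times> 'x \<Rightarrow> 'm) lin_data" where
  "QMod Q =
    \<lparr>Ob = {M. linear_category Q M},
     Hom = module_poset Q,
     tensor = module_tensor Q,
     tunit = hom_tensor,
     par = module_par Q,
     punit = hom_par\<rparr>"

end

theory Submission
  imports Defs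
begin

text \<open>
  If \<open>\<Q>\<close> is linear, suprema and \<open>\<otimes>\<close>-composites of modules are computed
  pointwise, and linear distributivity is exactly what makes a \<open>\<otimes>\<close>-composite compatible with
  the \<open>\<oplus>\<close>-actions.  The \<open>\<oplus>\<close> half follows by reversing the orders and exchanging
  \<open>\<otimes>\<close> with \<open>\<oplus>\<close>, in \<open>\<Q>\<close> and in every \<open>\<Q>\<close>-category.  Conversely,
  a one-object \<open>\<Q>\<close>-category with homs \<open>\<top>\<^sub>a\<close> and \<open>\<bottom>\<^sub>a\<close> exists
  without any linearity, and modules between such categories are just the morphisms of \<open>\<Q>\<close>; so
  linear distributivity of \<open>\<Q>-Mod\<close> restricts to \<open>\<Q>\<close>.
\<close>

section \<open>Complete lattices and quantaloids\<close>

text \<open>The infimum of \<open>A\<close> is the supremum of the set of its lower bounds, so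
  completeness of a hom of modules can be established by constructing suprema alone.\<close>

lemma (in partial_order) complete_lattice_if_sups:
  assumes sups: "\<And>A. A \<subseteq> carrier L \<Longrightarrow> \<exists>s. least L s (Upper L A)"
  shows "complete_lattice L"
proof (rule complete_latticeI)
  fix A assume A: "A \<subseteq> carrier L"
  obtain s where s: "least L s (Upper L (Lower L A))"
    using sups by (meson Lower_closed)
  have "greatest L s (Lower L A)"
  proof (rule greatest_LowerI)
    show "s \<sqsubseteq> x" if "x \<in> A" for x
      using s by (rule least_le) (use A that in \<open>auto intro!: Upper_memI\<close>)
    show "y \<sqsubseteq> s" if "y \<in> Lower L A" for y
      using s that by (rule least_Upper_above) simp
  qed (use A s in auto)
  then show "\<exists>i. greatest L i (Lower L A)" ..
qed (rule sups)

lemma (in partial_order) sup_eqI: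
  assumes "least L s (Upper L A)"
  shows "\<Squnion>A = s"
  unfolding sup_def using assms by (blast intro: least_unique)

section \<open>Order and supremum calculus in a single quantaloid\<close>

context quantaloid
begin

lemma poset: "a \<in> Ob \<Longrightarrow> b \<in> Ob \<Longrightarrow> partial_order (Hom a b)"
  using Hom_complete by (simp add: complete_lattice_def)

lemma weak_complete: "a \<in> Ob \<Longrightarrow> b \<in> Ob \<Longrightarrow> weak_complete_lattice (Hom a b)"
  using Hom_complete by (simp add: complete_lattice.axioms complete_lattice_def
    weak_complete_lattice_def partial_order_def complete_lattice_axioms_def
    weak_complete_lattice_axioms_def)

lemma le_refl:
  "\<lbrakk>a \<in> Ob; b \<in> Ob; f \<in> carrier (Hom a b)\<rbrakk> \<Longrightarrow> f \<sqsubseteq>\<^bsub>Hom a b\<^esub> f"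
  by (rule weak_partial_order.le_refl[OF partial_order.axioms(1)[OF poset]])

lemma le_trans:
  "\<lbrakk>f \<sqsubseteq>\<^bsub>Hom a b\<^esub> g; g \<sqsubseteq>\<^bsub>Hom a b\<^esub> h; a \<in> Ob; b \<in> Ob;
    f \<in> carrier (Hom a b); g \<in> carrier (Hom a b); h \<in> carrier (Hom a b)\<rbrakk>
    \<Longrightarrow> f \<sqsubseteq>\<^bsub>Hom a b\<^esub> h"
  by (rule weak_partial_order.le_trans[OF partial_order.axioms(1)[OF poset]])

lemma le_antisym:
  "\<lbrakk>f \<sqsubseteq>\<^bsub>Hom a b\<^esub> g; g \<sqsubseteq>\<^bsub>Hom a b\<^esub> f; a \<in> Ob; b \<in> Ob;
    f \<in> carrier (Hom a b); g \<in> carrier (Hom a b)\<rbrakk> \<Longrightarrow> f = g"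
  by (rule partial_order.le_antisym[OF poset])

text \<open>Testing with \<open>u = f\<close> and \<open>u = g\<close> gives both inequalities.
  Equalities between iterated suprema are proved in this form, because an upper bound of a supremum
  unfolds into a universal quantifier and quantifiers commute freely.\<close>

lemma eq_if_same_upper_bounds:
  assumes "a \<in> Ob" "b \<in> Ob" "f \<in> carrier (Hom a b)" "g \<in> carrier (Hom a b)"
    and "\<And>u. u \<in> carrier (Hom a b) \<Longrightarrow> f \<sqsubseteq>\<^bsub>Hom a b\<^esub> u \<longleftrightarrow> g \<sqsubseteq>\<^bsub>Hom a b\<^esub> u"
  shows "f = g"
  using assms(1-4) le_refl[of a b] assms(5)[of f] assms(5)[of g] by (blast intro: le_antisym[of a b])

lemma SUP_closed:
  assumes "a \<in> Ob" "b \<in> Ob" "\<And>i. i \<in> I \<Longrightarrow> F i \<in> carrier (Hom a b)"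
  shows "\<Squnion>\<^bsub>Hom a b\<^esub> (F ` I) \<in> carrier (Hom a b)"
  using assms by (intro weak_complete_lattice.sup_closed weak_complete) auto

lemma SUP_upper:
  assumes "a \<in> Ob" "b \<in> Ob" "\<And>i. i \<in> I \<Longrightarrow> F i \<in> carrier (Hom a b)" "i \<in> I"
  shows "F i \<sqsubseteq>\<^bsub>Hom a b\<^esub> \<Squnion>\<^bsub>Hom a b\<^esub> (F ` I)"
  using assms by (intro weak_complete_lattice.sup_upper weak_complete) auto

lemma SUP_le_iff:
  assumes "a \<in> Ob" "b \<in> Ob" "\<And>i. i \<in> I \<Longrightarrow> F i \<in> carrier (Hom a b)"
    and "u \<in> carrier (Hom a b)"
  shows "\<Squnion>\<^bsub>Hom a b\<^esub> (F ` I) \<sqsubseteq>\<^bsub>Hom a b\<^esub> u \<longleftrightarrow> (\<forall>i\<in>I. F i \<sqsubseteq>\<^bsub>Hom a b\<^esub> u)"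
proof
  assume le: "\<Squnion>\<^bsub>Hom a b\<^esub> (F ` I) \<sqsubseteq>\<^bsub>Hom a b\<^esub> u"
  show "\<forall>i\<in>I. F i \<sqsubseteq>\<^bsub>Hom a b\<^esub> u"
  proof
    fix i assume "i \<in> I"
    with assms have "F i \<sqsubseteq>\<^bsub>Hom a b\<^esub> \<Squnion>\<^bsub>Hom a b\<^esub> (F ` I)"
      by (intro SUP_upper)
    then show "F i \<sqsubseteq>\<^bsub>Hom a b\<^esub> u"
      using le by (rule le_trans) (use assms \<open>i \<in> I\<close> in \<open>auto intro: SUP_closed\<close>)
  qed
next
  assume "\<forall>i\<in>I. F i \<sqsubseteq>\<^bsub>Hom a b\<^esub> u"
  then show "\<Squnion>\<^bsub>Hom a b\<^esub> (F ` I) \<sqsubseteq>\<^bsub>Hom a b\<^esub> u"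
    using assms by (intro weak_complete_lattice.sup_least weak_complete) auto
qed

lemma SUP_leI:
  assumes "a \<in> Ob" "b \<in> Ob" "\<And>i. i \<in> I \<Longrightarrow> F i \<in> carrier (Hom a b)"
    and "u \<in> carrier (Hom a b)" "\<And>i. i \<in> I \<Longrightarrow> F i \<sqsubseteq>\<^bsub>Hom a b\<^esub> u"
  shows "\<Squnion>\<^bsub>Hom a b\<^esub> (F ` I) \<sqsubseteq>\<^bsub>Hom a b\<^esub> u"
  using assms by (simp add: SUP_le_iff)

lemma le_SUPI:
  assumes "a \<in> Ob" "b \<in> Ob" "\<And>i. i \<in> I \<Longrightarrow> F i \<in> carrier (Hom a b)" "i \<in> I"
    and "f \<sqsubseteq>\<^bsub>Hom a b\<^esub> F i" "f \<in> carrier (Hom a b)"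
  shows "f \<sqsubseteq>\<^bsub>Hom a b\<^esub> \<Squnion>\<^bsub>Hom a b\<^esub> (F ` I)"
  by (rule le_trans[OF assms(5) SUP_upper[of a b I F i]]) (use assms in \<open>auto intro: SUP_closed\<close>)

text \<open>Preservation of suprema, rephrased through upper bounds so that a supremum nested inside
  a composite also unfolds into a quantifier.\<close>

lemma comp_SUP_left_le_iff:
  assumes "a \<in> Ob" "b \<in> Ob" "c \<in> Ob" "\<And>i. i \<in> I \<Longrightarrow> F i \<in> carrier (Hom a b)"
    and "g \<in> carrier (Hom b c)" "u \<in> carrier (Hom a c)"
  shows "comp a b c (\<Squnion>\<^bsub>Hom a b\<^esub> (F ` I)) g \<sqsubseteq>\<^bsub>Hom a c\<^esub> u
    \<longleftrightarrow> (\<forall>i\<in>I. comp a b c (F i) g \<sqsubseteq>\<^bsub>Hom a c\<^esub> u)"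
  using assms by (simp add: comp_Sup_left image_subset_iff image_image SUP_le_iff comp_closed)

lemma comp_SUP_right_le_iff:
  assumes "a \<in> Ob" "b \<in> Ob" "c \<in> Ob" "f \<in> carrier (Hom a b)"
    and "\<And>i. i \<in> I \<Longrightarrow> G i \<in> carrier (Hom b c)" "u \<in> carrier (Hom a c)"
  shows "comp a b c f (\<Squnion>\<^bsub>Hom b c\<^esub> (G ` I)) \<sqsubseteq>\<^bsub>Hom a c\<^esub> u
    \<longleftrightarrow> (\<forall>i\<in>I. comp a b c f (G i) \<sqsubseteq>\<^bsub>Hom a c\<^esub> u)"
  using assms by (simp add: comp_Sup_right image_subset_iff image_image SUP_le_iff comp_closed)

text \<open>Prepares the derivation of monotonicity from preservation of suprema; the image under
  \<open>id\<close> presents the pair as an indexed family.\<close>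

lemma SUP_of_pair:
  assumes "a \<in> Ob" "b \<in> Ob" "f \<in> carrier (Hom a b)" "g \<in> carrier (Hom a b)"
    and "f \<sqsubseteq>\<^bsub>Hom a b\<^esub> g"
  shows "\<Squnion>\<^bsub>Hom a b\<^esub> (id ` {f, g}) = g"
proof (rule le_antisym)
  show "\<Squnion>\<^bsub>Hom a b\<^esub> (id ` {f, g}) \<sqsubseteq>\<^bsub>Hom a b\<^esub> g"
    using assms by (intro SUP_leI) (auto intro: le_refl)
  show "g \<sqsubseteq>\<^bsub>Hom a b\<^esub> \<Squnion>\<^bsub>Hom a b\<^esub> (id ` {f, g})"
    using assms by (intro le_SUPI[where i = g]) (auto intro: le_refl)
  show "\<Squnion>\<^bsub>Hom a b\<^esub> (id ` {f, g}) \<in> carrier (Hom a b)"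
    using assms by (intro SUP_closed) auto
qed (use assms in auto)

text \<open>Monotonicity is not among the axioms. Since \<open>f'\<close> is the supremum of
  \<open>{f, f'}\<close>, the composite of \<open>f'\<close> with \<open>g\<close> is the supremum
  of the two composites and hence lies above that of \<open>f\<close> with \<open>g\<close>.\<close>

lemma comp_mono_left:
  assumes "f \<sqsubseteq>\<^bsub>Hom a b\<^esub> f'" "a \<in> Ob" "b \<in> Ob" "c \<in> Ob"
    "f \<in> carrier (Hom a b)" "f' \<in> carrier (Hom a b)" "g \<in> carrier (Hom b c)"
  shows "comp a b c f g \<sqsubseteq>\<^bsub>Hom a c\<^esub> comp a b c f' g"
  using comp_SUP_left_le_iff[of a b c "{f, f'}" id g "comp a b c f' g"]
    SUP_of_pair[of a b f f'] assms by (auto simp: comp_closed le_refl)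

lemma comp_mono_right:
  assumes "g \<sqsubseteq>\<^bsub>Hom b c\<^esub> g'" "a \<in> Ob" "b \<in> Ob" "c \<in> Ob"
    "f \<in> carrier (Hom a b)" "g \<in> carrier (Hom b c)" "g' \<in> carrier (Hom b c)"
  shows "comp a b c f g \<sqsubseteq>\<^bsub>Hom a c\<^esub> comp a b c f g'"
  using comp_SUP_right_le_iff[of a b c f "{g, g'}" id "comp a b c f g'"]
    SUP_of_pair[of b c g g'] assms by (auto simp: comp_closed le_refl)

end

section \<open>The tensor quantaloid and the order-reversed par quantaloid\<close>

sublocale quantaloid_pair \<subseteq> T: quantaloid "Ob Q" "Hom Q" "tensor Q" "tunit Q"
  by (rule tensor_quantaloid)

sublocale quantaloid_pair \<subseteq> P: quantaloid "Ob Q" "\<lambda>a b. inv_gorder (Hom Q a b)" "par Q" "punit Q"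
  by (rule par_co_quantaloid)

context quantaloid_pair
begin

text \<open>Simplification removes the order reversal: suprema of
  \<open>inv_gorder (Hom Q a b)\<close> turn into infima of \<open>Hom Q a b\<close>, and the
  inequalities return to the original order.\<close>

lemmas par_closed = P.comp_closed[simplified]
lemmas punit_closed = P.ident_closed[simplified]
lemmas par_mono_left = P.comp_mono_left[simplified]
lemmas par_mono_right = P.comp_mono_right[simplified]
lemmas INF_greatest = P.SUP_leI[simplified]
lemmas INF_lower = P.SUP_upper[simplified]
lemmas INF_closed = P.SUP_closed[simplified]

end

section \<open>Q-categories and Q-modules\<close>

context linear_category
begin

lemma ext_closed: "x \<in> obj M \<Longrightarrow> ext M x \<in> Ob Q"
  using ext_fun by auto

lemma hom_tensor_closed:
  "\<lbrakk>x \<in> obj M; x' \<in> obj M\<rbrakk> \<Longrightarrow> hom_tensor M (x, x') \<in> carrier (Hom Q (ext M x) (ext M x'))"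
  using hom_tensor_fun by (auto simp: PiE_iff)

lemma hom_par_closed:
  "\<lbrakk>x \<in> obj M; x' \<in> obj M\<rbrakk> \<Longrightarrow> hom_par M (x, x') \<in> carrier (Hom Q (ext M x) (ext M x'))"
  using hom_par_fun by (auto simp: PiE_iff)

text \<open>Both tensor actions are \<open>tensor_comp\<close>, and the two par actions are the
  mixed axioms that bound \<open>hom_tensor\<close> from above. The mixed axioms that bound
  \<open>hom_par\<close> from below do the same for \<open>hom_par\<close>, by duality.\<close>

lemma module_hom_tensor: "linear_module Q M M (hom_tensor M)"
  by unfold_locales
    (rule hom_tensor_fun, auto intro: tensor_comp tensor_le_par_tensor tensor_le_tensor_par)

end

lemma (in linear_module) value_closed:
  "\<lbrakk>x \<in> obj M; y \<in> obj N\<rbrakk> \<Longrightarrow> \<Theta> (x, y) \<in> carrier (Hom Q (ext M x) (ext N y))"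
  using module_fun by (auto simp: PiE_iff)

lemma (in linear_module) undefined_outside: "\<not> (x \<in> obj M \<and> y \<in> obj N) \<Longrightarrow> \<Theta> (x, y) = undefined"
  using module_fun by (auto simp: PiE_iff extensional_def)

text \<open>Modules are extensional functions, so outside the product of the object sets both take
  the value \<open>undefined\<close>.\<close>

lemma module_eqI:
  assumes "linear_module Q M N \<Theta>" "linear_module Q M N \<Psi>"
    and "\<And>x y. \<lbrakk>x \<in> obj M; y \<in> obj N\<rbrakk> \<Longrightarrow> \<Theta> (x, y) = \<Psi> (x, y)"
  shows "\<Theta> = \<Psi>"
proof
  fix p show "\<Theta> p = \<Psi> p"
    using assms linear_module.undefined_outside[OF assms(1)]
      linear_module.undefined_outside[OF assms(2)] by (cases p) metis
qed

lemma module_poset_simps [simp]: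
  "carrier (module_poset Q M N) = {\<Theta>. linear_module Q M N \<Theta>}"
  "eq (module_poset Q M N) = (=)"
  "le (module_poset Q M N) \<Theta> \<Psi> \<longleftrightarrow>
    (\<forall>x \<in> obj M. \<forall>y \<in> obj N. \<Theta> (x, y) \<sqsubseteq>\<^bsub>Hom Q (ext M x) (ext N y)\<^esub> \<Psi> (x, y))"
  by (simp_all add: module_poset_def)

lemma QMod_simps [simp]:
  "Ob (QMod Q) = {M. linear_category Q M}"
  "Hom (QMod Q) = module_poset Q"
  "tensor (QMod Q) = module_tensor Q"
  "tunit (QMod Q) = hom_tensor"
  "par (QMod Q) = module_par Q"
  "punit (QMod Q) = hom_par"
  by (simp_all add: QMod_def)

definition module_Sup ::
  "('o, 'm) lin_data \<Rightarrow> ('x, 'o, 'm) lin_cat_data \<Rightarrow> ('x, 'o, 'm) lin_cat_data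
    \<Rightarrow> ('x \<times> 'x \<Rightarrow> 'm) set \<Rightarrow> 'x \<times> 'x \<Rightarrow> 'm" where
  "module_Sup Q M N A =
    (\<lambda>(x, y) \<in> obj M \<times> obj N. \<Squnion>\<^bsub>Hom Q (ext M x) (ext N y)\<^esub> ((\<lambda>\<Theta>. \<Theta> (x, y)) ` A))"

lemma module_Sup_apply:
  "\<lbrakk>x \<in> obj M; y \<in> obj N\<rbrakk> \<Longrightarrow>
    module_Sup Q M N A (x, y) = \<Squnion>\<^bsub>Hom Q (ext M x) (ext N y)\<^esub> ((\<lambda>\<Theta>. \<Theta> (x, y)) ` A)"
  by (simp add: module_Sup_def)

lemma module_tensor_apply:
  "\<lbrakk>x \<in> obj M; z \<in> obj P\<rbrakk> \<Longrightarrow>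
    module_tensor Q M N P \<Theta> \<Psi> (x, z) = \<Squnion>\<^bsub>Hom Q (ext M x) (ext P z)\<^esub>
        ((\<lambda>y. tensor Q (ext M x) (ext N y) (ext P z) (\<Theta> (x, y)) (\<Psi> (y, z))) ` obj N)"
  by (simp add: module_tensor_def)

lemma module_par_apply:
  "\<lbrakk>x \<in> obj M; z \<in> obj P\<rbrakk> \<Longrightarrow>
    module_par Q M N P \<Theta> \<Psi> (x, z) = \<Sqinter>\<^bsub>Hom Q (ext M x) (ext P z)\<^esub>
        ((\<lambda>y. par Q (ext M x) (ext N y) (ext P z) (\<Theta> (x, y)) (\<Psi> (y, z))) ` obj N)"
  by (simp add: module_par_def)

section \<open>Complete lattices of modules, with pointwise suprema\<close>

context quantaloid_pair
begin

lemma module_poset_partial_order: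
  assumes "linear_category Q M" "linear_category Q N"
  shows "partial_order (module_poset Q M N)"
proof -
  interpret M: linear_category Q M by fact
  interpret N: linear_category Q N by fact
  show ?thesis
  proof (unfold_locales; simp?)
    show "\<forall>x\<in>obj M. \<forall>y\<in>obj N. \<Theta> (x, y) \<sqsubseteq>\<^bsub>Hom Q (ext M x) (ext N y)\<^esub> \<Theta> (x, y)"
      if "linear_module Q M N \<Theta>" for \<Theta>
      using linear_module.value_closed[OF that] by (auto intro: T.le_refl M.ext_closed N.ext_closed)
  next
    fix \<Theta> \<Psi>
    assume le: "\<forall>x\<in>obj M. \<forall>y\<in>obj N. \<Theta> (x, y) \<sqsubseteq>\<^bsub>Hom Q (ext M x) (ext N y)\<^esub> \<Psi> (x, y)"
       "\<forall>x\<in>obj M. \<forall>y\<in>obj N. \<Psi> (x, y) \<sqsubseteq>\<^bsub>Hom Q (ext M x) (ext N y)\<^esub> \<Theta> (x, y)"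
      and mods: "linear_module Q M N \<Theta>" "linear_module Q M N \<Psi>"
    show "\<Theta> = \<Psi>"
    proof (rule module_eqI[OF mods])
      fix x y assume "x \<in> obj M" "y \<in> obj N"
      then show "\<Theta> (x, y) = \<Psi> (x, y)"
        using le mods[THEN linear_module.value_closed]
        by (intro T.le_antisym[of "ext M x" "ext N y"]) (auto intro: M.ext_closed N.ext_closed)
    qed
  next
    fix \<Theta> \<Psi> \<Phi>
    assume le: "\<forall>x\<in>obj M. \<forall>y\<in>obj N. \<Theta> (x, y) \<sqsubseteq>\<^bsub>Hom Q (ext M x) (ext N y)\<^esub> \<Psi> (x, y)"
       "\<forall>x\<in>obj M. \<forall>y\<in>obj N. \<Psi> (x, y) \<sqsubseteq>\<^bsub>Hom Q (ext M x) (ext N y)\<^esub> \<Phi> (x, y)"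
      and mods: "linear_module Q M N \<Theta>" "linear_module Q M N \<Psi>" "linear_module Q M N \<Phi>"
    show "\<forall>x\<in>obj M. \<forall>y\<in>obj N. \<Theta> (x, y) \<sqsubseteq>\<^bsub>Hom Q (ext M x) (ext N y)\<^esub> \<Phi> (x, y)"
    proof (intro ballI)
      fix x y assume "x \<in> obj M" "y \<in> obj N"
      then show "\<Theta> (x, y) \<sqsubseteq>\<^bsub>Hom Q (ext M x) (ext N y)\<^esub> \<Phi> (x, y)"
        using le mods[THEN linear_module.value_closed]
        by - (rule T.le_trans[of "ext M x" "ext N y" "\<Theta> (x, y)" "\<Psi> (x, y)"],
            auto intro: M.ext_closed N.ext_closed)
    qed
  qed
qed

text \<open>The tensor actions pass to the supremum because \<otimes> preserves suprema in each
  variable. For the par actions monotonicity of \<oplus> suffices: each member satisfies its own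
  law, and replacing the member by the supremum on the right only enlarges that side.\<close>

lemma module_Sup_module:
  assumes "linear_category Q M" "linear_category Q N"
    and A: "\<And>\<Theta>. \<Theta> \<in> A \<Longrightarrow> linear_module Q M N \<Theta>"
  shows "linear_module Q M N (module_Sup Q M N A)"
proof -
  interpret M: linear_category Q M by fact
  interpret N: linear_category Q N by fact
  note vc = linear_module.value_closed[OF A]
  note cl = vc M.ext_closed N.ext_closed M.hom_tensor_closed M.hom_par_closed
    N.hom_tensor_closed N.hom_par_closed T.comp_closed par_closed
  have Sc: "module_Sup Q M N A (x, y) \<in> carrier (Hom Q (ext M x) (ext N y))"
    if "x \<in> obj M" "y \<in> obj N" for x y
    using that by (auto simp: module_Sup_apply cl intro!: T.SUP_closed)
  have up: "\<Theta> (x, y) \<sqsubseteq>\<^bsub>Hom Q (ext M x) (ext N y)\<^esub> module_Sup Q M N A (x, y)"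
    if "x \<in> obj M" "y \<in> obj N" "\<Theta> \<in> A" for x y \<Theta>
    using that by (auto simp: module_Sup_apply cl intro!: T.le_SUPI T.le_refl)
  show ?thesis
  proof
    show "module_Sup Q M N A \<in> (\<Pi>\<^sub>E (x, y) \<in> obj M \<times> obj N. carrier (Hom Q (ext M x) (ext N y)))"
      using Sc by (auto simp: PiE_iff) (auto simp: module_Sup_def)
  next
    fix x y y' assume xy: "x \<in> obj M" "y \<in> obj N" "y' \<in> obj N"
    have "tensor Q (ext M x) (ext N y) (ext N y') (\<Theta> (x, y)) (hom_tensor N (y, y'))
      \<sqsubseteq>\<^bsub>Hom Q (ext M x) (ext N y')\<^esub> module_Sup Q M N A (x, y')" if "\<Theta> \<in> A" for \<Theta>
      by (rule T.le_trans[OF linear_module.tensor_right[OF A] up]) (use xy that Sc cl in auto)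
    then show "tensor Q (ext M x) (ext N y) (ext N y') (module_Sup Q M N A (x, y))
      (hom_tensor N (y, y')) \<sqsubseteq>\<^bsub>Hom Q (ext M x) (ext N y')\<^esub> module_Sup Q M N A (x, y')"
      unfolding module_Sup_apply[OF xy(1,2)]
      by (subst T.comp_SUP_left_le_iff) (use xy Sc cl in auto)
    have "\<Theta> (x, y) \<sqsubseteq>\<^bsub>Hom Q (ext M x) (ext N y)\<^esub>
      par Q (ext M x) (ext N y') (ext N y) (module_Sup Q M N A (x, y')) (hom_par N (y', y))"
      if "\<Theta> \<in> A" for \<Theta>
      by (rule T.le_trans[OF linear_module.par_right[OF A] par_mono_left[OF up]])
        (use xy that Sc cl in auto)
    then show "module_Sup Q M N A (x, y) \<sqsubseteq>\<^bsub>Hom Q (ext M x) (ext N y)\<^esub>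
      par Q (ext M x) (ext N y') (ext N y) (module_Sup Q M N A (x, y')) (hom_par N (y', y))"
      unfolding module_Sup_apply[OF xy(1,2)]
      by (intro T.SUP_leI) (use xy Sc cl in auto)
  next
    fix x x' y assume xy: "x \<in> obj M" "x' \<in> obj M" "y \<in> obj N"
    have "tensor Q (ext M x) (ext M x') (ext N y) (hom_tensor M (x, x')) (\<Theta> (x', y))
      \<sqsubseteq>\<^bsub>Hom Q (ext M x) (ext N y)\<^esub> module_Sup Q M N A (x, y)" if "\<Theta> \<in> A" for \<Theta>
      by (rule T.le_trans[OF linear_module.tensor_left[OF A] up]) (use xy that Sc cl in auto)
    then show "tensor Q (ext M x) (ext M x') (ext N y) (hom_tensor M (x, x'))
      (module_Sup Q M N A (x', y)) \<sqsubseteq>\<^bsub>Hom Q (ext M x) (ext N y)\<^esub> module_Sup Q M N A (x, y)"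
      unfolding module_Sup_apply[OF xy(2,3)]
      by (subst T.comp_SUP_right_le_iff) (use xy Sc cl in auto)
    have "\<Theta> (x, y) \<sqsubseteq>\<^bsub>Hom Q (ext M x) (ext N y)\<^esub>
      par Q (ext M x) (ext M x') (ext N y) (hom_par M (x, x')) (module_Sup Q M N A (x', y))"
      if "\<Theta> \<in> A" for \<Theta>
      by (rule T.le_trans[OF linear_module.par_left[OF A] par_mono_right[OF up]])
        (use xy that Sc cl in auto)
    then show "module_Sup Q M N A (x, y) \<sqsubseteq>\<^bsub>Hom Q (ext M x) (ext N y)\<^esub>
      par Q (ext M x) (ext M x') (ext N y) (hom_par M (x, x')) (module_Sup Q M N A (x', y))"
      unfolding module_Sup_apply[OF xy(1,3)]
      by (intro T.SUP_leI) (use xy Sc cl in auto)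
  qed
qed

lemma module_Sup_least:
  assumes "linear_category Q M" "linear_category Q N"
    and A: "A \<subseteq> carrier (module_poset Q M N)"
  shows "least (module_poset Q M N) (module_Sup Q M N A) (Upper (module_poset Q M N) A)"
proof -
  interpret M: linear_category Q M by fact
  interpret N: linear_category Q N by fact
  have mods: "linear_module Q M N \<Theta>" if "\<Theta> \<in> A" for \<Theta>
    using A that by auto
  note cl = linear_module.value_closed[OF mods] M.ext_closed N.ext_closed
  have "linear_module Q M N (module_Sup Q M N A)"
    using assms(1,2) mods by (rule module_Sup_module)
  then show ?thesis
    using A
    by (intro least_UpperI)
      (auto simp: module_Sup_apply Upper_def cl linear_module.value_closed
        intro!: T.SUP_leI T.le_SUPI T.le_refl)
qed

text \<open>Identifies the supremum that the order determines abstractly with the pointwise one, so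
  that preservation of suprema can be checked entry by entry.\<close>

lemma Sup_module_poset:
  assumes "linear_category Q M" "linear_category Q N" "A \<subseteq> carrier (module_poset Q M N)"
  shows "\<Squnion>\<^bsub>module_poset Q M N\<^esub> A = module_Sup Q M N A"
  using assms by (intro partial_order.sup_eqI module_poset_partial_order module_Sup_least)

lemma module_poset_complete_lattice:
  assumes "linear_category Q M" "linear_category Q N"
  shows "complete_lattice (module_poset Q M N)"
  using module_poset_partial_order[OF assms]
proof (rule partial_order.complete_lattice_if_sups)
  fix A assume "A \<subseteq> carrier (module_poset Q M N)"
  then show "\<exists>s. least (module_poset Q M N) s (Upper (module_poset Q M N) A)"
    using module_Sup_least[OF assms] by blast
qed

end

section \<open>The tensor quantaloid of modules over a linear quantaloid\<close>

context linear_quantaloid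
begin

text \<open>For the tensor actions, associativity moves the acting hom next to the outer factor,
  which absorbs it. For the par actions, the outer factor is first expanded by its own par law and
  linear distributivity then carries the new hom out of the tensor.\<close>

lemma module_tensor_module:
  assumes "linear_category Q M" "linear_category Q N" "linear_category Q P"
    and "linear_module Q M N \<Theta>" "linear_module Q N P \<Psi>"
  shows "linear_module Q M P (module_tensor Q M N P \<Theta> \<Psi>)"
proof -
  interpret M: linear_category Q M by fact
  interpret N: linear_category Q N by fact
  interpret P: linear_category Q P by fact
  interpret \<Theta>: linear_module Q M N \<Theta> by fact
  interpret \<Psi>: linear_module Q N P \<Psi> by fact
  let ?C = "module_tensor Q M N P \<Theta> \<Psi>"
  note cl = \<Theta>.value_closed \<Psi>.value_closed M.ext_closed N.ext_closed P.ext_closed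
    M.hom_tensor_closed M.hom_par_closed P.hom_tensor_closed P.hom_par_closed
    T.comp_closed par_closed
  have Sc: "?C (x, z) \<in> carrier (Hom Q (ext M x) (ext P z))"
    if "x \<in> obj M" "z \<in> obj P" for x z
    using that by (auto simp: module_tensor_apply cl intro!: T.SUP_closed)
  have up: "tensor Q (ext M x) (ext N y) (ext P z) (\<Theta> (x, y)) (\<Psi> (y, z))
      \<sqsubseteq>\<^bsub>Hom Q (ext M x) (ext P z)\<^esub> ?C (x, z)"
    if "x \<in> obj M" "y \<in> obj N" "z \<in> obj P" for x y z
    unfolding module_tensor_apply[OF that(1,3)]
    by (rule T.le_SUPI[where i = y]) (use that in \<open>auto simp: cl intro!: T.le_refl\<close>)
  show ?thesis
  proof
    show "?C \<in> (\<Pi>\<^sub>E (x, y) \<in> obj M \<times> obj P. carrier (Hom Q (ext M x) (ext P y)))"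
      using Sc by (auto simp: PiE_iff) (auto simp: module_tensor_def)
  next
    fix x z z' assume xz: "x \<in> obj M" "z \<in> obj P" "z' \<in> obj P"
    have "tensor Q (ext M x) (ext P z) (ext P z')
        (tensor Q (ext M x) (ext N y) (ext P z) (\<Theta> (x, y)) (\<Psi> (y, z))) (hom_tensor P (z, z'))
      \<sqsubseteq>\<^bsub>Hom Q (ext M x) (ext P z')\<^esub> ?C (x, z')" if "y \<in> obj N" for y
      by (subst T.comp_assoc; (rule T.le_trans[OF T.comp_mono_right[OF \<Psi>.tensor_right] up])?)
        (use xz that Sc cl in auto)
    then show "tensor Q (ext M x) (ext P z) (ext P z') (?C (x, z))
      (hom_tensor P (z, z')) \<sqsubseteq>\<^bsub>Hom Q (ext M x) (ext P z')\<^esub> ?C (x, z')"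
      unfolding module_tensor_apply[OF xz(1,2)]
      by (subst T.comp_SUP_left_le_iff) (use xz Sc cl in auto)
    \<comment> \<open>The chain is \<Theta> \<otimes> \<Psi> \<le> \<Theta> \<otimes> (\<Psi>
      \<oplus> p) \<le> (\<Theta> \<otimes> \<Psi>) \<oplus> p \<le> C \<oplus> p, where p is an
      entry of \<open>hom_par P\<close> and C the composite; the middle step is
      \<open>lin_dist_left\<close>.\<close>
    have "tensor Q (ext M x) (ext N y) (ext P z) (\<Theta> (x, y)) (\<Psi> (y, z))
       \<sqsubseteq>\<^bsub>Hom Q (ext M x) (ext P z)\<^esub>
         par Q (ext M x) (ext P z') (ext P z) (?C (x, z')) (hom_par P (z', z))"
      if y: "y \<in> obj N" for y
      by (rule T.le_trans[OF T.comp_mono_right[OF \<Psi>.par_right]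
            T.le_trans[OF lin_dist_left par_mono_left[OF up]]])
        (use xz y Sc cl in auto)
    then show "?C (x, z) \<sqsubseteq>\<^bsub>Hom Q (ext M x) (ext P z)\<^esub>
      par Q (ext M x) (ext P z') (ext P z) (?C (x, z')) (hom_par P (z', z))"
      unfolding module_tensor_apply[OF xz(1,2)]
      by (intro T.SUP_leI) (use xz Sc cl in auto)
  next
    fix x x' z assume xz: "x \<in> obj M" "x' \<in> obj M" "z \<in> obj P"
    have "tensor Q (ext M x) (ext M x') (ext P z) (hom_tensor M (x, x'))
        (tensor Q (ext M x') (ext N y) (ext P z) (\<Theta> (x', y)) (\<Psi> (y, z)))
      \<sqsubseteq>\<^bsub>Hom Q (ext M x) (ext P z)\<^esub> ?C (x, z)" if "y \<in> obj N" for y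
      by (subst T.comp_assoc[symmetric];
          (rule T.le_trans[OF T.comp_mono_left[OF \<Theta>.tensor_left] up])?)
        (use xz that Sc cl in auto)
    then show "tensor Q (ext M x) (ext M x') (ext P z) (hom_tensor M (x, x')) (?C (x', z))
      \<sqsubseteq>\<^bsub>Hom Q (ext M x) (ext P z)\<^esub> ?C (x, z)"
      unfolding module_tensor_apply[OF xz(2,3)]
      by (subst T.comp_SUP_right_le_iff) (use xz Sc cl in auto)
    \<comment> \<open>The mirrored chain: \<Theta> is expanded by its left par law, and
      \<open>lin_dist_right\<close> moves the entry of \<open>hom_par M\<close> to the
      front.\<close>
    have "tensor Q (ext M x) (ext N y) (ext P z) (\<Theta> (x, y)) (\<Psi> (y, z))
       \<sqsubseteq>\<^bsub>Hom Q (ext M x) (ext P z)\<^esub>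
         par Q (ext M x) (ext M x') (ext P z) (hom_par M (x, x')) (?C (x', z))"
      if y: "y \<in> obj N" for y
      by (rule T.le_trans[OF T.comp_mono_left[OF \<Theta>.par_left]
            T.le_trans[OF lin_dist_right par_mono_right[OF up]]])
        (use xz y Sc cl in auto)
    then show "?C (x, z) \<sqsubseteq>\<^bsub>Hom Q (ext M x) (ext P z)\<^esub>
      par Q (ext M x) (ext M x') (ext P z) (hom_par M (x, x')) (?C (x', z))"
      unfolding module_tensor_apply[OF xz(1,3)]
      by (intro T.SUP_leI) (use xz Sc cl in auto)
  qed
qed

text \<open>An upper bound of either side at (x, w) is an upper bound of all triple composites
  through middle objects of \<open>N\<close> and \<open>P\<close>. The two sides differ only in
  bracketing and in the order of the two quantifiers.\<close>

lemma module_tensor_assoc: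
  assumes "linear_category Q M" "linear_category Q N" "linear_category Q P" "linear_category Q R"
    and "linear_module Q M N \<Theta>" "linear_module Q N P \<Psi>" "linear_module Q P R \<Phi>"
  shows "module_tensor Q M P R (module_tensor Q M N P \<Theta> \<Psi>) \<Phi>
    = module_tensor Q M N R \<Theta> (module_tensor Q N P R \<Psi> \<Phi>)"
    (is "?L = ?R")
proof (rule module_eqI)
  show L: "linear_module Q M R ?L" and R: "linear_module Q M R ?R"
    using assms by (auto intro!: module_tensor_module)
  interpret M: linear_category Q M by fact
  interpret N: linear_category Q N by fact
  interpret P: linear_category Q P by fact
  interpret R: linear_category Q R by fact
  interpret \<Theta>: linear_module Q M N \<Theta> by fact
  interpret \<Psi>: linear_module Q N P \<Psi> by fact
  interpret \<Phi>: linear_module Q P R \<Phi> by fact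
  note cl = \<Theta>.value_closed \<Psi>.value_closed \<Phi>.value_closed
    M.ext_closed N.ext_closed P.ext_closed R.ext_closed T.comp_closed
  fix x w assume xw: "x \<in> obj M" "w \<in> obj R"
  show "?L (x, w) = ?R (x, w)"
  proof (rule T.eq_if_same_upper_bounds[of "ext M x" "ext R w"])
    fix u assume u: "u \<in> carrier (Hom Q (ext M x) (ext R w))"
    show "?L (x, w) \<sqsubseteq>\<^bsub>Hom Q (ext M x) (ext R w)\<^esub> u \<longleftrightarrow> ?R (x, w) \<sqsubseteq>\<^bsub>Hom Q (ext M x) (ext R w)\<^esub> u"
      using xw u
      by (auto simp: module_tensor_apply T.SUP_le_iff T.comp_SUP_left_le_iff
          T.comp_SUP_right_le_iff T.SUP_closed cl T.comp_assoc)
  qed (use xw cl linear_module.value_closed[OF L] linear_module.value_closed[OF R] in auto)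
qed

text \<open>Every term of the join is below \<Theta> by its left tensor action. Conversely, the term
  at the middle object \<open>x\<close> is above \<Theta>, because the unit lies below
  \<open>hom_tensor M (x, x)\<close>.\<close>

lemma module_tensor_ident_left:
  assumes "linear_category Q M" "linear_category Q N" "linear_module Q M N \<Theta>"
  shows "module_tensor Q M M N (hom_tensor M) \<Theta> = \<Theta>"
    (is "?L = _")
proof (rule module_eqI)
  interpret M: linear_category Q M by fact
  interpret N: linear_category Q N by fact
  interpret \<Theta>: linear_module Q M N \<Theta> by fact
  show L: "linear_module Q M N ?L"
    using assms by (auto intro!: module_tensor_module M.module_hom_tensor)
  show "linear_module Q M N \<Theta>" by fact
  note cl = \<Theta>.value_closed M.ext_closed N.ext_closed M.hom_tensor_closed
    T.comp_closed T.ident_closed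
  fix x y assume xy: "x \<in> obj M" "y \<in> obj N"
  show "?L (x, y) = \<Theta> (x, y)"
  proof (rule T.le_antisym)
    show "?L (x, y) \<sqsubseteq>\<^bsub>Hom Q (ext M x) (ext N y)\<^esub> \<Theta> (x, y)"
      using xy by (auto simp: module_tensor_apply cl intro!: T.SUP_leI \<Theta>.tensor_left)
    have "tensor Q (ext M x) (ext M x) (ext N y) (tunit Q (ext M x)) (\<Theta> (x, y))
      \<sqsubseteq>\<^bsub>Hom Q (ext M x) (ext N y)\<^esub>
        tensor Q (ext M x) (ext M x) (ext N y) (hom_tensor M (x, x)) (\<Theta> (x, y))"
      by (rule T.comp_mono_left[OF M.tensor_unit]) (use xy cl in auto)
    then have "\<Theta> (x, y) \<sqsubseteq>\<^bsub>Hom Q (ext M x) (ext N y)\<^esub>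
        tensor Q (ext M x) (ext M x) (ext N y) (hom_tensor M (x, x)) (\<Theta> (x, y))"
      using xy by (simp add: T.ident_left cl)
    then show "\<Theta> (x, y) \<sqsubseteq>\<^bsub>Hom Q (ext M x) (ext N y)\<^esub> ?L (x, y)"
      unfolding module_tensor_apply[OF xy]
      by (intro T.le_SUPI[where i = x]) (use xy cl in auto)
  qed (use xy cl linear_module.value_closed[OF L] in auto)
qed

text \<open>Mirror image of the left unit law, with the right tensor action and the term at the
  middle object \<open>y\<close>.\<close>

lemma module_tensor_ident_right:
  assumes "linear_category Q M" "linear_category Q N" "linear_module Q M N \<Theta>"
  shows "module_tensor Q M N N \<Theta> (hom_tensor N) = \<Theta>"
    (is "?L = _")
proof (rule module_eqI)
  interpret M: linear_category Q M by fact
  interpret N: linear_category Q N by fact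
  interpret \<Theta>: linear_module Q M N \<Theta> by fact
  show L: "linear_module Q M N ?L"
    using assms by (auto intro!: module_tensor_module N.module_hom_tensor)
  show "linear_module Q M N \<Theta>" by fact
  note cl = \<Theta>.value_closed M.ext_closed N.ext_closed N.hom_tensor_closed
    T.comp_closed T.ident_closed
  fix x y assume xy: "x \<in> obj M" "y \<in> obj N"
  show "?L (x, y) = \<Theta> (x, y)"
  proof (rule T.le_antisym)
    show "?L (x, y) \<sqsubseteq>\<^bsub>Hom Q (ext M x) (ext N y)\<^esub> \<Theta> (x, y)"
      using xy by (auto simp: module_tensor_apply cl intro!: T.SUP_leI \<Theta>.tensor_right)
    have "tensor Q (ext M x) (ext N y) (ext N y) (\<Theta> (x, y)) (tunit Q (ext N y))
      \<sqsubseteq>\<^bsub>Hom Q (ext M x) (ext N y)\<^esub>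
        tensor Q (ext M x) (ext N y) (ext N y) (\<Theta> (x, y)) (hom_tensor N (y, y))"
      by (rule T.comp_mono_right[OF N.tensor_unit]) (use xy cl in auto)
    then have "\<Theta> (x, y) \<sqsubseteq>\<^bsub>Hom Q (ext M x) (ext N y)\<^esub>
        tensor Q (ext M x) (ext N y) (ext N y) (\<Theta> (x, y)) (hom_tensor N (y, y))"
      using xy by (simp add: T.ident_right cl)
    then show "\<Theta> (x, y) \<sqsubseteq>\<^bsub>Hom Q (ext M x) (ext N y)\<^esub> ?L (x, y)"
      unfolding module_tensor_apply[OF xy]
      by (intro T.le_SUPI[where i = y]) (use xy cl in auto)
  qed (use xy cl linear_module.value_closed[OF L] in auto)
qed

text \<open>For both sides, being below \<open>u\<close> at (x, z) means the same bound for every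
  member of \<open>A\<close> and every middle object, since \<otimes> preserves suprema in its first
  variable.\<close>

lemma module_tensor_Sup_left:
  assumes "linear_category Q M" "linear_category Q N" "linear_category Q P"
    and A: "\<And>\<Theta>. \<Theta> \<in> A \<Longrightarrow> linear_module Q M N \<Theta>" and "linear_module Q N P \<Psi>"
  shows "module_tensor Q M N P (module_Sup Q M N A) \<Psi>
    = module_Sup Q M P ((\<lambda>\<Theta>. module_tensor Q M N P \<Theta> \<Psi>) ` A)"
    (is "?L = ?R")
proof (rule module_eqI)
  show L: "linear_module Q M P ?L" and R: "linear_module Q M P ?R"
    using assms by (auto intro!: module_tensor_module module_Sup_module)
  interpret M: linear_category Q M by fact
  interpret N: linear_category Q N by fact
  interpret P: linear_category Q P by fact
  interpret \<Psi>: linear_module Q N P \<Psi> by fact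
  note cl = linear_module.value_closed[OF A] \<Psi>.value_closed
    M.ext_closed N.ext_closed P.ext_closed T.comp_closed
  fix x z assume xz: "x \<in> obj M" "z \<in> obj P"
  show "?L (x, z) = ?R (x, z)"
  proof (rule T.eq_if_same_upper_bounds[of "ext M x" "ext P z"])
    fix u assume u: "u \<in> carrier (Hom Q (ext M x) (ext P z))"
    show "?L (x, z) \<sqsubseteq>\<^bsub>Hom Q (ext M x) (ext P z)\<^esub> u \<longleftrightarrow> ?R (x, z) \<sqsubseteq>\<^bsub>Hom Q (ext M x) (ext P z)\<^esub> u"
      using xz u
      by (auto simp: module_tensor_apply module_Sup_apply image_image T.SUP_le_iff
          T.comp_SUP_left_le_iff T.SUP_closed cl)
  qed (use xz cl linear_module.value_closed[OF L] linear_module.value_closed[OF R] in auto)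
qed

lemma module_tensor_Sup_right:
  assumes "linear_category Q M" "linear_category Q N" "linear_category Q P"
    and "linear_module Q M N \<Theta>" and B: "\<And>\<Psi>. \<Psi> \<in> B \<Longrightarrow> linear_module Q N P \<Psi>"
  shows "module_tensor Q M N P \<Theta> (module_Sup Q N P B)
    = module_Sup Q M P ((\<lambda>\<Psi>. module_tensor Q M N P \<Theta> \<Psi>) ` B)"
    (is "?L = ?R")
proof (rule module_eqI)
  show L: "linear_module Q M P ?L" and R: "linear_module Q M P ?R"
    using assms by (auto intro!: module_tensor_module module_Sup_module)
  interpret M: linear_category Q M by fact
  interpret N: linear_category Q N by fact
  interpret P: linear_category Q P by fact
  interpret \<Theta>: linear_module Q M N \<Theta> by fact
  note cl = linear_module.value_closed[OF B] \<Theta>.value_closed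
    M.ext_closed N.ext_closed P.ext_closed T.comp_closed
  fix x z assume xz: "x \<in> obj M" "z \<in> obj P"
  show "?L (x, z) = ?R (x, z)"
  proof (rule T.eq_if_same_upper_bounds[of "ext M x" "ext P z"])
    fix u assume u: "u \<in> carrier (Hom Q (ext M x) (ext P z))"
    show "?L (x, z) \<sqsubseteq>\<^bsub>Hom Q (ext M x) (ext P z)\<^esub> u \<longleftrightarrow> ?R (x, z) \<sqsubseteq>\<^bsub>Hom Q (ext M x) (ext P z)\<^esub> u"
      using xz u
      by (auto simp: module_tensor_apply module_Sup_apply image_image T.SUP_le_iff
          T.comp_SUP_right_le_iff T.SUP_closed cl)
  qed (use xz cl linear_module.value_closed[OF L] linear_module.value_closed[OF R] in auto)
qed

lemma module_tensor_quantaloid: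
  "quantaloid {M. linear_category Q M} (module_poset Q) (module_tensor Q) hom_tensor"
proof (rule quantaloid.intro, goal_cases)
  case (1 a b) then show ?case by (simp add: module_poset_complete_lattice)
next
  case (2 a) then show ?case by (simp add: linear_category.module_hom_tensor)
next
  case (3 a b c f g) then show ?case by (simp add: module_tensor_module)
next
  case (4 a b c d f g h) then show ?case by (simp add: module_tensor_assoc)
next
  case (5 a b f) then show ?case by (simp add: module_tensor_ident_left)
next
  case (6 a b f) then show ?case by (simp add: module_tensor_ident_right)
next
  case (7 a b c A g)
  \<comment> \<open>Membership in the carrier allows the supremum of the image to be computed
    pointwise as well.\<close>
  then have "(\<lambda>f. module_tensor Q a b c f g) ` A \<subseteq> carrier (module_poset Q a c)"
    by (auto intro!: module_tensor_module)
  with 7 show ?case by (simp add: Sup_module_poset module_tensor_Sup_left subset_iff)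
next
  case (8 a b c f B)
  then have "(\<lambda>g. module_tensor Q a b c f g) ` B \<subseteq> carrier (module_poset Q a c)"
    by (auto intro!: module_tensor_module)
  with 8 show ?case by (simp add: Sup_module_poset module_tensor_Sup_right subset_iff)
qed

end

text \<open>The left side is a join over \<open>N\<close> and the right side a meet over
  \<open>P\<close>, so it suffices to compare one term of each; there the distributive law of
  \<open>Q\<close> applies.\<close>

lemma (in linear_quantaloid) module_lin_dist_left:
  assumes "linear_category Q M" "linear_category Q N" "linear_category Q P" "linear_category Q R"
    and "linear_module Q M N \<Theta>" "linear_module Q N P \<Psi>" "linear_module Q P R \<Phi>"
  shows "module_tensor Q M N R \<Theta> (module_par Q N P R \<Psi> \<Phi>)
    \<sqsubseteq>\<^bsub>module_poset Q M R\<^esub> module_par Q M P R (module_tensor Q M N P \<Theta> \<Psi>) \<Phi>"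
proof -
  interpret M: linear_category Q M by fact
  interpret N: linear_category Q N by fact
  interpret P: linear_category Q P by fact
  interpret R: linear_category Q R by fact
  interpret \<Theta>: linear_module Q M N \<Theta> by fact
  interpret \<Psi>: linear_module Q N P \<Psi> by fact
  interpret \<Phi>: linear_module Q P R \<Phi> by fact
  note cl = \<Theta>.value_closed \<Psi>.value_closed \<Phi>.value_closed
    M.ext_closed N.ext_closed P.ext_closed R.ext_closed T.comp_closed par_closed
  {
    fix x y z w assume xyzw: "x \<in> obj M" "y \<in> obj N" "z \<in> obj P" "w \<in> obj R"
    let ?inf = "\<Sqinter>\<^bsub>Hom Q (ext N y) (ext R w)\<^esub>
      ((\<lambda>z. par Q (ext N y) (ext P z) (ext R w) (\<Psi> (y, z)) (\<Phi> (z, w))) ` obj P)"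
    let ?sup = "\<Squnion>\<^bsub>Hom Q (ext M x) (ext P z)\<^esub>
      ((\<lambda>y. tensor Q (ext M x) (ext N y) (ext P z) (\<Theta> (x, y)) (\<Psi> (y, z))) ` obj N)"
    have inf_closed: "?inf \<in> carrier (Hom Q (ext N y) (ext R w))"
      using xyzw by (intro INF_closed) (auto simp: cl)
    have sup_closed: "?sup \<in> carrier (Hom Q (ext M x) (ext P z))"
      using xyzw by (intro T.SUP_closed) (auto simp: cl)
    have inf_le: "?inf \<sqsubseteq>\<^bsub>Hom Q (ext N y) (ext R w)\<^esub>
        par Q (ext N y) (ext P z) (ext R w) (\<Psi> (y, z)) (\<Phi> (z, w))"
      by (rule INF_lower[where i = z]) (use xyzw cl in auto)
    have le_sup: "tensor Q (ext M x) (ext N y) (ext P z) (\<Theta> (x, y)) (\<Psi> (y, z))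
        \<sqsubseteq>\<^bsub>Hom Q (ext M x) (ext P z)\<^esub> ?sup"
      by (rule T.SUP_upper[where i = y]) (use xyzw cl in auto)
    \<comment> \<open>Pass from the inner meet to its entry at \<open>z\<close>, apply
      \<open>lin_dist_left\<close>, and pass from the entry at \<open>y\<close> to the inner
      join.\<close>
    have "tensor Q (ext M x) (ext N y) (ext R w) (\<Theta> (x, y)) ?inf \<sqsubseteq>\<^bsub>Hom Q (ext M x) (ext R w)\<^esub>
        par Q (ext M x) (ext P z) (ext R w) ?sup (\<Phi> (z, w))"
      by (rule T.le_trans[OF T.comp_mono_right[OF inf_le]
            T.le_trans[OF lin_dist_left par_mono_left[OF le_sup]]])
        (use xyzw inf_closed sup_closed in \<open>auto simp: cl\<close>)
  }
  then show ?thesis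
    by (auto simp: module_tensor_apply module_par_apply cl T.SUP_closed INF_closed
        intro!: T.SUP_leI INF_greatest)
qed

section \<open>Duality\<close>

text \<open>Only the order on homs is reversed; arrows keep their direction and composition stays
  diagrammatic.\<close>

definition dual_data :: "('o, 'm) lin_data \<Rightarrow> ('o, 'm) lin_data" where
  "dual_data Q =
    \<lparr>Ob = Ob Q, Hom = (\<lambda>a b. inv_gorder (Hom Q a b)),
     tensor = par Q, tunit = punit Q, par = tensor Q, punit = tunit Q\<rparr>"

definition dual_cat :: "('x, 'o, 'm) lin_cat_data \<Rightarrow> ('x, 'o, 'm) lin_cat_data" where
  "dual_cat M =
    \<lparr>obj = obj M, ext = ext M, hom_tensor = hom_par M, hom_par = hom_tensor M\<rparr>"

lemma dual_data_simps [simp]: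
  "Ob (dual_data Q) = Ob Q"
  "Hom (dual_data Q) a b = inv_gorder (Hom Q a b)"
  "tensor (dual_data Q) = par Q"
  "tunit (dual_data Q) = punit Q"
  "par (dual_data Q) = tensor Q"
  "punit (dual_data Q) = tunit Q"
  by (simp_all add: dual_data_def)

lemma dual_cat_simps [simp]:
  "obj (dual_cat M) = obj M"
  "ext (dual_cat M) = ext M"
  "hom_tensor (dual_cat M) = hom_par M"
  "hom_par (dual_cat M) = hom_tensor M"
  by (simp_all add: dual_cat_def)

text \<open>Reversing the order and exchanging the compositions turns each distributive law into the
  other one.\<close>

lemma (in linear_quantaloid) dual_linear_quantaloid: "linear_quantaloid (dual_data Q)"
proof (intro linear_quantaloid.intro quantaloid_pair.intro linear_quantaloid_axioms.intro,
    goal_cases)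
  case 1 show ?case using par_co_quantaloid by (simp add: dual_data_def)
next
  case 2 show ?case
    unfolding dual_data_def lin_data.simps inv_gorder_inv by (rule tensor_quantaloid)
next
  case 3 then show ?case by (simp add: lin_dist_right)
next
  case 4 then show ?case by (simp add: lin_dist_left)
qed

text \<open>The axioms come in dual pairs: unit with unit, composition with composition, and each
  mixed bound on \<open>hom_tensor\<close> with a mixed bound on \<open>hom_par\<close>.\<close>

lemma linear_category_dual_iff [simp]:
  "linear_category (dual_data Q) (dual_cat M) \<longleftrightarrow> linear_category Q M"
  by (auto simp: linear_category_def)

lemma linear_module_dual_iff [simp]:
  "linear_module (dual_data Q) (dual_cat M) (dual_cat N) \<Theta> \<longleftrightarrow> linear_module Q M N \<Theta>"
  by (auto simp: linear_module_def)

lemma module_poset_dual: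
  "module_poset (dual_data Q) (dual_cat M) (dual_cat N) = inv_gorder (module_poset Q M N)"
  by (simp add: module_poset_def)

lemma module_tensor_dual [simp]:
  "module_tensor (dual_data Q) (dual_cat M) (dual_cat N) (dual_cat P) = module_par Q M N P"
  by (intro ext) (simp add: module_tensor_def module_par_def)

lemma module_par_dual [simp]:
  "module_par (dual_data Q) (dual_cat M) (dual_cat N) (dual_cat P) = module_tensor Q M N P"
  by (intro ext) (simp add: module_tensor_def module_par_def)

text \<open>The axioms mention objects only through homs, composites and identities, so they can be
  pulled back along any map of objects. It transports the result for the dual data along
  \<open>dual_cat\<close>.\<close>

lemma quantaloid_reindex:
  assumes "quantaloid O' H k e" "\<And>a. a \<in> A \<Longrightarrow> \<phi> a \<in> O'"
  shows "quantaloid A (\<lambda>a b. H (\<phi> a) (\<phi> b)) (\<lambda>a b c. k (\<phi> a) (\<phi> b) (\<phi> c)) (\<lambda>a. e (\<phi> a))"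
proof -
  interpret quantaloid O' H k e by fact
  show ?thesis
    by (rule quantaloid.intro)
      (simp_all add: assms(2) Hom_complete ident_closed comp_closed comp_assoc ident_left
        ident_right comp_Sup_left comp_Sup_right)
qed

section \<open>The par quantaloid of modules and the linear structure\<close>

context linear_quantaloid
begin

lemma module_par_quantaloid:
  "quantaloid {M. linear_category Q M} (\<lambda>M N. inv_gorder (module_poset Q M N)) (module_par Q) hom_par"
  using quantaloid_reindex[OF linear_quantaloid.module_tensor_quantaloid[OF dual_linear_quantaloid],
      of "{M. linear_category Q M}" dual_cat]
  by (simp add: module_poset_dual del: module_poset_simps)

text \<open>This is the left law over the dual data: the exchange of joins with meets and of
  \<otimes> with \<oplus>, together with the reversed order, swaps its two sides.\<close>

lemma module_lin_dist_right:
  assumes "linear_category Q M" "linear_category Q N" "linear_category Q P" "linear_category Q R"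
    and "linear_module Q M N \<Theta>" "linear_module Q N P \<Psi>" "linear_module Q P R \<Phi>"
  shows "module_tensor Q M P R (module_par Q M N P \<Theta> \<Psi>) \<Phi>
    \<sqsubseteq>\<^bsub>module_poset Q M R\<^esub> module_par Q M N R \<Theta> (module_tensor Q N P R \<Psi> \<Phi>)"
  using linear_quantaloid.module_lin_dist_left[OF dual_linear_quantaloid,
      of "dual_cat M" "dual_cat N" "dual_cat P" "dual_cat R" \<Theta> \<Psi> \<Phi>] assms
  by simp

lemma QMod_linear_quantaloid: "linear_quantaloid (QMod Q)"
proof (intro linear_quantaloid.intro quantaloid_pair.intro linear_quantaloid_axioms.intro,
    goal_cases)
  case 1 then show ?case using module_tensor_quantaloid by simp
next
  case 2 then show ?case using module_par_quantaloid by (simp del: module_poset_simps)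
next
  case 3 then show ?case
    by (simp del: module_poset_simps(3)) (rule module_lin_dist_left)
next
  case 4 then show ?case
    by (simp del: module_poset_simps(3)) (rule module_lin_dist_right)
qed

end

section \<open>One-object Q-categories\<close>

definition point_cat :: "('o, 'm) lin_data \<Rightarrow> 'x \<Rightarrow> 'o \<Rightarrow> ('x, 'o, 'm) lin_cat_data" where
  "point_cat Q x a =
    \<lparr>obj = {x}, ext = (\<lambda>_ \<in> {x}. a),
     hom_tensor = (\<lambda>_ \<in> {(x, x)}. tunit Q a), hom_par = (\<lambda>_ \<in> {(x, x)}. punit Q a)\<rparr>"

lemma point_cat_simps [simp]:
  "obj (point_cat Q x a) = {x}"
  "ext (point_cat Q x a) x = a"
  "hom_tensor (point_cat Q x a) (x, x) = tunit Q a"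
  "hom_par (point_cat Q x a) (x, x) = punit Q a"
  by (simp_all add: point_cat_def)

context quantaloid_pair
begin

lemmas par_ident_left = P.ident_left[simplified]
lemmas par_ident_right = P.ident_right[simplified]

text \<open>All homs are units, so each axiom reduces to reflexivity by a unit law; for instance
  \<bottom> \<oplus> \<top> = \<top> and \<top> \<otimes> \<bottom> = \<bottom> for the mixed
  ones.\<close>

lemma linear_category_point_cat:
  assumes "a \<in> Ob Q"
  shows "linear_category Q (point_cat Q x a)"
  by (rule linear_category.intro)
    (use assms in \<open>auto simp: T.ident_closed punit_closed T.ident_left T.ident_right
      par_ident_left par_ident_right T.le_refl PiE_iff\<close>, auto simp: point_cat_def)

lemma linear_module_point_cat:
  assumes "a \<in> Ob Q" "b \<in> Ob Q" "f \<in> carrier (Hom Q a b)"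
  shows "linear_module Q (point_cat Q x a) (point_cat Q x b) (\<lambda>_ \<in> {(x, x)}. f)"
  by (rule linear_module.intro)
    (use assms in \<open>auto simp: T.ident_left T.ident_right par_ident_left par_ident_right
      T.le_refl PiE_iff\<close>)

text \<open>The join runs over the single middle object \<open>x\<close>, hence is the supremum of a
  singleton.\<close>

lemma module_tensor_point_cat:
  assumes "a \<in> Ob Q" "b \<in> Ob Q" "c \<in> Ob Q" "f \<in> carrier (Hom Q a b)" "g \<in> carrier (Hom Q b c)"
  shows "module_tensor Q (point_cat Q x a) (point_cat Q x b) (point_cat Q x c)
      (\<lambda>_ \<in> {(x, x)}. f) (\<lambda>_ \<in> {(x, x)}. g) = (\<lambda>_ \<in> {(x, x)}. tensor Q a b c f g)"
  using partial_order.sup_of_singleton[OF T.poset] assms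
  by (auto simp: module_tensor_def fun_eq_iff T.comp_closed)

lemma module_par_point_cat:
  assumes "a \<in> Ob Q" "b \<in> Ob Q" "c \<in> Ob Q" "f \<in> carrier (Hom Q a b)" "g \<in> carrier (Hom Q b c)"
  shows "module_par Q (point_cat Q x a) (point_cat Q x b) (point_cat Q x c)
      (\<lambda>_ \<in> {(x, x)}. f) (\<lambda>_ \<in> {(x, x)}. g) = (\<lambda>_ \<in> {(x, x)}. par Q a b c f g)"
  using partial_order.inf_of_singleton[OF T.poset] assms
  by (auto simp: module_par_def fun_eq_iff par_closed)

lemma linear_quantaloid_if_QMod:
  assumes "linear_quantaloid (QMod Q :: (('x, 'o, 'm) lin_cat_data, 'x \<times> 'x \<Rightarrow> 'm) lin_data)"
  shows "linear_quantaloid Q"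
proof
  interpret QMod: linear_quantaloid
    "QMod Q :: (('x, 'o, 'm) lin_cat_data, 'x \<times> 'x \<Rightarrow> 'm) lin_data" by fact
  fix a b c d f g h
  assume ob: "a \<in> Ob Q" "b \<in> Ob Q" "c \<in> Ob Q" "d \<in> Ob Q"
    and hom: "f \<in> carrier (Hom Q a b)" "g \<in> carrier (Hom Q b c)" "h \<in> carrier (Hom Q c d)"
  \<comment> \<open>Any element of \<open>'x\<close> serves as the single object;
    \<open>undefined\<close> supplies one because types are nonempty, so one point is enough
    whatever the type of objects is.\<close>
  let ?pt = "point_cat Q (undefined :: 'x)" and ?md = "\<lambda>f. \<lambda>_ \<in> {(undefined :: 'x, undefined :: 'x)}. f"
  note rules = linear_category_point_cat linear_module_point_cat module_tensor_point_cat
    module_par_point_cat T.comp_closed par_closed ob hom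
  show "tensor Q a b d f (par Q b c d g h) \<sqsubseteq>\<^bsub>Hom Q a d\<^esub> par Q a c d (tensor Q a b c f g) h"
    using QMod.lin_dist_left[of "?pt a" "?pt b" "?pt c" "?pt d" "?md f" "?md g" "?md h"]
    by (simp add: rules)
  show "tensor Q a c d (par Q a b c f g) h \<sqsubseteq>\<^bsub>Hom Q a d\<^esub> par Q a b d f (tensor Q b c d g h)"
    using QMod.lin_dist_right[of "?pt a" "?pt b" "?pt c" "?pt d" "?md f" "?md g" "?md h"]
    by (simp add: rules)
qed

end

theorem theorem6p8:
  fixes Q :: "('o, 'm) lin_data"
  assumes "quantaloid_pair Q"
  shows "linear_quantaloid
      (QMod Q :: (('x, 'o, 'm) lin_cat_data, 'x \<times> 'x \<Rightarrow> 'm) lin_data)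
    \<longleftrightarrow> linear_quantaloid Q"
  using quantaloid_pair.linear_quantaloid_if_QMod[OF assms]
    linear_quantaloid.QMod_linear_quantaloid by blast

end
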